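(* Let $\mathbb{X},\mathbb{Y}$ be any two real normed linear spaces. Let $T,A:\mathbb{X}\to\mathbb{Y}$ be bounded linear operators such that $T\perp_B A$. Let $\mathcal{O}$ denote the collection of all s.i.p. on $\mathbb{Y}$. Let $\epsilon>0$ be arbitrary but fixed after choice. Then $$\|T\|=\max\{l_1(\epsilon),l_2(\epsilon)\}=\max\{l_1(\epsilon),l_3(\epsilon)\},$$ where $l_1(\epsilon)=\sup\{[Tx,y]:x\in S_{\mathbb{X}},\ y\in S_{\mathbb{Y}},\ [\cdot,\cdot]\in\mathcal{O},\ |[Ax,y]|<\epsilon\}$, $l_2(\epsilon)=\sup\{[Tx,y]:x\in S_{\mathbb{X}},\ y\in S_{\mathbb{Y}},\ [\cdot,\cdot]\in\mathcal{O},\ Ax\in y^{+\epsilon}\}$, $l_3(\epsilon)=\sup\{[Tx,y]:x\in S_{\mathbb{X}},\ y\in S_{\mathbb{Y}},\ [\cdot,\cdot]\in\mathcal{O},\ Ax\in y^{-\epsilon}\}$.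
   Context: All normed spaces are real; $S_{\mathbb{X}}=\{x\in\mathbb{X}:\|x\|=1\}$ and similarly $S_{\mathbb{Y}}$. $T\perp_B A$ (Birkhoff-James orthogonality) means $\|T+\lambda A\|\ge\|T\|$ for all $\lambda\in\mathbb{R}$, in the operator norm. For $u,v$ in a normed space, the notation $v\in u^{+\epsilon}$ means $\|u+\lambda v\|\ge\sqrt{1-\epsilon^2}\,\|u\|$ for all $\lambda\ge 0$, and $v\in u^{-\epsilon}$ means $\|u+\lambda v\|\ge\sqrt{1-\epsilon^2}\,\|u\|$ for all $\lambda\le 0$ (in the literature this notation is introduced for $\epsilon\in[0,1)$). A semi-inner-product (s.i.p.) on a real normed space $\mathbb{Y}$ is a function $[\cdot,\cdot]:\mathbb{Y}\times\mathbb{Y}\to\mathbb{R}$ such that for all $\alpha,\beta\in\mathbb{R}$ and $x,y,z\in\mathbb{Y}$: (a) $[\alpha x+\beta y,z]=\alpha[x,z]+\beta[y,z]$; (b) $[x,x]>0$ whenever $x\ne 0$; (c) $|[x,y]|^2\le[x,x][y,y]$; (d) $[x,\alpha y]=\alpha[x,y]$. Every s.i.p. is assumed compatible with the norm: $[x,x]=\|x\|^2$ for all $x$. *)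

theory Defs
  imports "HOL-Analysis.Analysis"
begin

definition birkhoff_james_orthogonal :: "'a::real_normed_vector \<Rightarrow> 'a \<Rightarrow> bool"
    (infix "\<bottom>\<^sub>B" 50) where
  "u \<bottom>\<^sub>B v \<longleftrightarrow> (\<forall>l::real. norm (u + l *\<^sub>R v) \<ge> norm u)"

text \<open>
  The sets \<open>u\<^sup>+\<^sup>\<epsilon>\<close> and \<open>u\<^sup>-\<^sup>\<epsilon>\<close>. The notation is usually introduced for \<open>0 \<le> \<epsilon> < 1\<close>.
  Since \<^term>\<open>sqrt\<close> is nonpositive on nonpositive reals, for \<open>\<epsilon> \<ge> 1\<close> the inequality
  imposes no condition and both sets are the whole space.
\<close>

definition approx_pos :: "real \<Rightarrow> 'a::real_normed_vector \<Rightarrow> 'a set" where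
  "approx_pos \<epsilon> u = {v. \<forall>l\<ge>0. norm (u + l *\<^sub>R v) \<ge> sqrt (1 - \<epsilon>\<^sup>2) * norm u}"

definition approx_neg :: "real \<Rightarrow> 'a::real_normed_vector \<Rightarrow> 'a set" where
  "approx_neg \<epsilon> u = {v. \<forall>l\<le>0. norm (u + l *\<^sub>R v) \<ge> sqrt (1 - \<epsilon>\<^sup>2) * norm u}"

definition semi_inner_product :: "('a::real_vector \<Rightarrow> 'a \<Rightarrow> real) \<Rightarrow> bool" where
  "semi_inner_product s \<longleftrightarrow>
     (\<forall>\<alpha> \<beta> x y z. s (\<alpha> *\<^sub>R x + \<beta> *\<^sub>R y) z = \<alpha> * s x z + \<beta> * s y z) \<and>
     (\<forall>x. x \<noteq> 0 \<longrightarrow> s x x > 0) \<and>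
     (\<forall>x y. \<bar>s x y\<bar>\<^sup>2 \<le> s x x * s y y) \<and>
     (\<forall>\<alpha> x y. s x (\<alpha> *\<^sub>R y) = \<alpha> * s x y)"

definition compatible_sips :: "('a::real_normed_vector \<Rightarrow> 'a \<Rightarrow> real) set" where
  "compatible_sips = {s. semi_inner_product s \<and> (\<forall>x. s x x = (norm x)\<^sup>2)}"

text \<open>
  Supremum of a set of reals with the convention \<open>sup \<emptyset> = 0\<close>; on the reals \<^term>\<open>Sup {}\<close> is
  an unspecified number. The convention agrees with \<open>\<parallel>T\<parallel> = sup {\<parallel>T x\<parallel> | \<parallel>x\<parallel> = 1}\<close> on the zero
  space. It is needed when one of the spaces is zero (all three sets below are then empty)
  and because the set defining \<open>l\<^sub>1\<close> can be empty on nonzero spaces. The sets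
  below are bounded above by \<open>\<parallel>T\<parallel>\<close>, by the Cauchy-Schwarz inequality for semi-inner-products.
\<close>

definition sup0 :: "real set \<Rightarrow> real" where
  "sup0 S = (if S = {} then 0 else Sup S)"

definition l1 :: "('a::real_normed_vector \<Rightarrow>\<^sub>L 'b::real_normed_vector) \<Rightarrow> ('a \<Rightarrow>\<^sub>L 'b) \<Rightarrow> real \<Rightarrow> real" where
  "l1 T A \<epsilon> = sup0 {s (blinfun_apply T x) y | x y s.
     x \<in> sphere 0 1 \<and> y \<in> sphere 0 1 \<and> s \<in> compatible_sips \<and> \<bar>s (blinfun_apply A x) y\<bar> < \<epsilon>}"

definition l2 :: "('a::real_normed_vector \<Rightarrow>\<^sub>L 'b::real_normed_vector) \<Rightarrow> ('a \<Rightarrow>\<^sub>L 'b) \<Rightarrow> real \<Rightarrow> real" where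
  "l2 T A \<epsilon> = sup0 {s (blinfun_apply T x) y | x y s.
     x \<in> sphere 0 1 \<and> y \<in> sphere 0 1 \<and> s \<in> compatible_sips \<and> blinfun_apply A x \<in> approx_pos \<epsilon> y}"

definition l3 :: "('a::real_normed_vector \<Rightarrow>\<^sub>L 'b::real_normed_vector) \<Rightarrow> ('a \<Rightarrow>\<^sub>L 'b) \<Rightarrow> real \<Rightarrow> real" where
  "l3 T A \<epsilon> = sup0 {s (blinfun_apply T x) y | x y s.
     x \<in> sphere 0 1 \<and> y \<in> sphere 0 1 \<and> s \<in> compatible_sips \<and> blinfun_apply A x \<in> approx_neg \<epsilon> y}"

end

theory Submission
  imports Defs
begin

text \<open>
  Choose a unit vector \<open>x\<close> at which \<open>T + \<lambda>A\<close> (\<open>\<lambda> > 0\<close> small) almost attains its norm, which is at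
  least \<open>\<parallel>T\<parallel>\<close>, and let \<open>y\<close> be the normalization of \<open>(T + \<lambda>A)x\<close>. Then \<open>[Tx, y] + \<lambda>[Ax, y]\<close> almost
  reaches \<open>\<parallel>T\<parallel>\<close>, so \<open>[Tx, y]\<close> is close to \<open>\<parallel>T\<parallel>\<close>, and \<open>[Ax, y] > -\<epsilon>\<close> because \<open>[Tx, y] \<le> \<parallel>T\<parallel>\<close>.
  Either \<open>\<bar>[Ax, y]\<bar> < \<epsilon>\<close>, or \<open>[Ax, y] \<ge> \<epsilon> > 0\<close>, and then \<open>\<parallel>y + lAx\<parallel> \<ge> [y + lAx, y] \<ge> 1\<close> for all
  \<open>l \<ge> 0\<close>. The third supremum is the second one for \<open>-A\<close>. Compatible semi-inner-products exist by
  the Hahn-Banach theorem, which follows here from the linearity of the minimal sublinear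
  functionals.
\<close>

section \<open>Sublinear functionals\<close>

definition sublinear :: "('a::real_vector \<Rightarrow> real) \<Rightarrow> bool" where
  "sublinear p \<longleftrightarrow> (\<forall>x y. p (x + y) \<le> p x + p y) \<and> (\<forall>c\<ge>0. \<forall>x. p (c *\<^sub>R x) \<le> c * p x)"

lemma sublinearI:
  assumes "\<And>x y. p (x + y) \<le> p x + p y" "\<And>c x. c \<ge> 0 \<Longrightarrow> p (c *\<^sub>R x) \<le> c * p x"
  shows "sublinear p"
  using assms by (auto simp: sublinear_def)

lemma sublinear_add: "sublinear p \<Longrightarrow> p (x + y) \<le> p x + p y"
  by (auto simp: sublinear_def)

lemma sublinear_scale_le: "sublinear p \<Longrightarrow> c \<ge> 0 \<Longrightarrow> p (c *\<^sub>R x) \<le> c * p x"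
  by (auto simp: sublinear_def)

lemma sublinear_zero:
  assumes "sublinear p"
  shows "p 0 = 0"
  using sublinear_add[OF assms, of 0 0] sublinear_scale_le[OF assms, of 0 0] by simp

lemma sublinear_scale:
  assumes "sublinear p" "c \<ge> 0"
  shows "p (c *\<^sub>R x) = c * p x"
proof (cases "c = 0")
  case False
  with assms have "c > 0" by simp
  have "p x \<le> (1 / c) * p (c *\<^sub>R x)"
    using sublinear_scale_le[OF assms(1), of "1 / c" "c *\<^sub>R x"] \<open>c > 0\<close> by simp
  then have "c * p x \<le> p (c *\<^sub>R x)"
    using \<open>c > 0\<close> by (simp add: field_simps)
  then show ?thesis
    using sublinear_scale_le[OF assms] by (simp add: order_antisym)
qed (simp add: sublinear_zero[OF assms(1)])

lemma sublinear_minus: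
  assumes "sublinear p"
  shows "- p (- x) \<le> p x"
  using sublinear_add[OF assms, of x "- x"] sublinear_zero[OF assms] by simp

lemma sublinear_norm: "sublinear (norm :: 'a::real_normed_vector \<Rightarrow> real)"
  by (rule sublinearI) (auto simp: norm_triangle_ineq)

text \<open>For sublinear \<open>p\<close> this is the largest sublinear functional below
  \<open>p\<close> whose value at \<open>- y\<close> is at most \<open>- p y\<close>; a linear
  functional below it therefore agrees with \<open>p\<close> at \<open>y\<close>.\<close>

definition directional_inf :: "('a::real_vector \<Rightarrow> real) \<Rightarrow> 'a \<Rightarrow> 'a \<Rightarrow> real" where
  "directional_inf p y x = (INF t\<in>{0..}. p (x + t *\<^sub>R y) - t * p y)"

lemma directional_inf_le:
  assumes "sublinear p" "t \<ge> 0"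
  shows "directional_inf p y x \<le> p (x + t *\<^sub>R y) - t * p y"
proof -
  \<comment> \<open>The infimum is finite: subadditivity splits \<open>t *\<^sub>R y\<close> as
    \<open>(x + t *\<^sub>R y) + (- x)\<close>.\<close>
  have "- p (- x) \<le> p (x + t *\<^sub>R y) - t * p y" if "t \<ge> 0" for t
    using sublinear_add[OF assms(1), of "x + t *\<^sub>R y" "- x"] sublinear_scale[OF assms(1) that, of y]
    by simp
  then have "bdd_below ((\<lambda>t. p (x + t *\<^sub>R y) - t * p y) ` {0..})"
    by (intro bdd_belowI2[of _ "- p (- x)"]) auto
  then show ?thesis
    unfolding directional_inf_def using assms(2) by (intro cINF_lower) auto
qed

lemma directional_inf_greatest:
  assumes "\<And>t. t \<ge> 0 \<Longrightarrow> m \<le> p (x + t *\<^sub>R y) - t * p y"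
  shows "m \<le> directional_inf p y x"
  unfolding directional_inf_def using assms by (intro cINF_greatest) auto

lemma directional_inf_le_self: "sublinear p \<Longrightarrow> directional_inf p y x \<le> p x"
  using directional_inf_le[of p 0 y x] by simp

lemma sublinear_directional_inf:
  assumes p: "sublinear p"
  shows "sublinear (directional_inf p y)"
proof (rule sublinearI)
  fix u v
  \<comment> \<open>The parameters \<open>t\<close> for \<open>u\<close> and \<open>r\<close> for
    \<open>v\<close> combine to \<open>t + r\<close> for \<open>u + v\<close>. The infima over
    \<open>r\<close> and \<open>t\<close> are then taken one after the other.\<close>
  have *: "directional_inf p y (u + v) \<le> (p (u + t *\<^sub>R y) - t * p y) + (p (v + r *\<^sub>R y) - r * p y)"
    if "t \<ge> 0" "r \<ge> 0" for t r
    using directional_inf_le[OF p, of "t + r" y "u + v"] that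
      sublinear_add[OF p, of "u + t *\<^sub>R y" "v + r *\<^sub>R y"]
    by (simp add: algebra_simps)
  have "directional_inf p y (u + v) - (p (u + t *\<^sub>R y) - t * p y) \<le> directional_inf p y v"
    if "t \<ge> 0" for t
    by (rule directional_inf_greatest) (use *[OF that] in \<open>force simp: algebra_simps\<close>)
  then have "directional_inf p y (u + v) - directional_inf p y v \<le> directional_inf p y u"
    by (intro directional_inf_greatest) (force simp: algebra_simps)
  then show "directional_inf p y (u + v) \<le> directional_inf p y u + directional_inf p y v"
    by simp
next
  fix c :: real and x
  assume "c \<ge> 0"
  show "directional_inf p y (c *\<^sub>R x) \<le> c * directional_inf p y x"
  proof (cases "c = 0")
    case True
    then show ?thesis
      using directional_inf_le_self[OF p, of y 0] sublinear_zero[OF p] by simp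
  next
    case False
    with \<open>c \<ge> 0\<close> have "c > 0" by simp
    have "directional_inf p y (c *\<^sub>R x) / c \<le> p (x + t *\<^sub>R y) - t * p y" if "t \<ge> 0" for t
      using directional_inf_le[OF p, of "c * t" y "c *\<^sub>R x"] that \<open>c > 0\<close>
        sublinear_scale[OF p \<open>c \<ge> 0\<close>, of "x + t *\<^sub>R y"]
      by (simp add: field_simps)
    then have "directional_inf p y (c *\<^sub>R x) / c \<le> directional_inf p y x"
      by (rule directional_inf_greatest)
    then show ?thesis
      using \<open>c > 0\<close> by (simp add: field_simps)
  qed
qed

section \<open>The Hahn-Banach theorem via minimal sublinear functionals\<close>

text \<open>By minimality \<open>directional_inf p y\<close> is \<open>p\<close> itself, and its
  bound at \<open>t = 1\<close> is the missing superadditivity. Additivity makes \<open>p\<close>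
  odd, which gives homogeneity for negative scalars.\<close>

lemma minimal_sublinear_imp_linear:
  assumes p: "sublinear p" and min: "\<And>q. sublinear q \<Longrightarrow> (\<And>x. q x \<le> p x) \<Longrightarrow> q = p"
  shows "linear p"
proof -
  have add: "p (x + y) = p x + p y" for x y
  proof (rule order_antisym)
    have "directional_inf p y = p"
      by (intro min sublinear_directional_inf p directional_inf_le_self)
    then show "p x + p y \<le> p (x + y)"
      using directional_inf_le[OF p, of 1 y x] by simp
  qed (rule sublinear_add[OF p])
  have neg: "p (- x) = - p x" for x
    using add[of x "- x"] sublinear_zero[OF p] by simp
  have "p (c *\<^sub>R x) = c *\<^sub>R p x" for c x
  proof (cases "c \<ge> 0")
    case False
    then show ?thesis
      using sublinear_scale[OF p, of "- c" x] neg[of "c *\<^sub>R x"] by simp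
  qed (simp add: sublinear_scale[OF p])
  with add show ?thesis
    by (rule linearI)
qed

lemma linear_below_sublinear:
  fixes p :: "'a::real_vector \<Rightarrow> real"
  assumes p: "sublinear p"
  obtains f where "linear f" "\<And>x. f x \<le> p x"
proof -
  define A where "A = {q. sublinear q \<and> q \<le> p}"
  \<comment> \<open>Zorn's lemma is used for the reversed order, so the maximal element is a minimal
    functional; chains are bounded by their pointwise infimum.\<close>
  have "\<exists>m\<in>A. \<forall>q\<in>A. m \<ge> q \<longrightarrow> q = m"
  proof (rule predicate_Zorn)
    show "partial_order_on A (relation_of (\<ge>) A)"
      by (rule partial_order_on_relation_ofI) auto
  next
    fix C assume C: "C \<in> Chains (relation_of (\<ge>) A)"
    then have sub: "C \<subseteq> A"
      by (auto simp: Chains_def relation_of_def)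
    have total: "q \<le> r \<or> r \<le> q" if "q \<in> C" "r \<in> C" for q r
      using C that by (auto simp: Chains_def relation_of_def)
    show "\<exists>u\<in>A. \<forall>q\<in>C. q \<ge> u"
    proof (cases "C = {}")
      case True
      then show ?thesis using p by (auto simp: A_def)
    next
      case False
      define u where "u x = (INF q\<in>C. q x)" for x
      have "- p (- x) \<le> q x" if "q \<in> C" for q x
      proof -
        have "sublinear q" "q (- x) \<le> p (- x)"
          using that sub by (auto simp: A_def le_fun_def)
        then show ?thesis
          using sublinear_minus[of q x] by simp
      qed
      then have "bdd_below ((\<lambda>q. q x) ` C)" for x
        by (intro bdd_belowI2)
      then have lower: "u x \<le> q x" if "q \<in> C" for q x
        unfolding u_def using that by (intro cINF_lower)
      have greatest: "m \<le> u x" if "\<And>q. q \<in> C \<Longrightarrow> m \<le> q x" for m x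
        unfolding u_def using False that by (intro cINF_greatest)
      have "sublinear u"
      proof (rule sublinearI)
        fix x y
        \<comment> \<open>Members of a chain are comparable, so the smaller of \<open>q\<close> and
          \<open>r\<close> lies below both, and its subadditivity suffices.\<close>
        have *: "u (x + y) \<le> q x + r y" if qr: "q \<in> C" "r \<in> C" for q r
        proof -
          obtain s where s: "s \<in> C" "s \<le> q" "s \<le> r"
            using total[OF qr] qr by blast
          then have "s (x + y) \<le> s x + s y"
            using sub by (intro sublinear_add) (auto simp: A_def)
          moreover have "s x \<le> q x" "s y \<le> r y"
            using s by (auto simp: le_fun_def)
          ultimately show ?thesis
            using lower[OF s(1), of "x + y"] by linarith
        qed
        have "u (x + y) - q x \<le> u y" if "q \<in> C" for q
          by (rule greatest) (use *[OF that] in \<open>force simp: algebra_simps\<close>)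
        then have "u (x + y) - u y \<le> u x"
          by (intro greatest) (force simp: algebra_simps)
        then show "u (x + y) \<le> u x + u y" by simp
      next
        fix c :: real and x
        assume "c \<ge> 0"
        have *: "u (c *\<^sub>R x) \<le> c * q x" if "q \<in> C" for q
          using lower[OF that, of "c *\<^sub>R x"] sublinear_scale_le[of q, OF _ \<open>c \<ge> 0\<close>, of x] that sub
          by (force simp: A_def)
        show "u (c *\<^sub>R x) \<le> c * u x"
        proof (cases "c = 0")
          case True
          with False * show ?thesis by auto
        next
          case False
          then have "c > 0" using \<open>c \<ge> 0\<close> by simp
          have "u (c *\<^sub>R x) / c \<le> u x"
            by (rule greatest) (use * \<open>c > 0\<close> in \<open>simp add: field_simps\<close>)
          then show ?thesis using \<open>c > 0\<close> by (simp add: field_simps)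
        qed
      qed
      moreover have "u \<le> p"
      proof -
        obtain q where "q \<in> C" using False by blast
        then have "u \<le> q" "q \<le> p" using lower sub by (auto simp: A_def le_fun_def)
        then show ?thesis by (rule order_trans)
      qed
      ultimately show ?thesis
        using lower by (intro bexI[of _ u]) (auto simp: A_def le_fun_def)
    qed
  qed
  then obtain f where f: "sublinear f" "f \<le> p" and min: "\<And>q. q \<in> A \<Longrightarrow> q \<le> f \<Longrightarrow> q = f"
    by (auto simp: A_def)
  have "linear f"
  proof (rule minimal_sublinear_imp_linear[OF f(1)])
    fix q assume "sublinear q" "\<And>x. q x \<le> f x"
    then show "q = f"
      using f(2) by (intro min) (auto simp: A_def le_fun_def intro: order_trans)
  qed
  with f(2) that show ?thesis
    by (auto simp: le_fun_def)
qed

section \<open>Norming functionals and existence of semi-inner-products\<close>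

text \<open>Any linear functional below \<open>directional_inf norm y\<close> works:
  \<open>t = 0\<close> bounds it by the norm, and \<open>t = 1\<close> at \<open>- y\<close> forces
  the value \<open>norm y\<close> at \<open>y\<close>.\<close>

lemma norming_functional:
  fixes y :: "'a::real_normed_vector"
  obtains f :: "'a \<Rightarrow> real" where "linear f" "\<And>x. \<bar>f x\<bar> \<le> norm x" "f y = norm y"
proof -
  obtain f :: "'a \<Rightarrow> real" where f: "linear f" "\<And>x. f x \<le> directional_inf norm y x"
    using linear_below_sublinear[OF sublinear_directional_inf[OF sublinear_norm]] by blast
  have le: "f x \<le> norm x" for x
    using f(2)[of x] directional_inf_le_self[OF sublinear_norm, of y x] by simp
  have neg: "f (- x) = - f x" for x
    using f(1) by (rule linear_neg)
  have "f (- y) \<le> - norm y"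
    using f(2)[of "- y"] directional_inf_le[OF sublinear_norm, of 1 y "- y"] by simp
  then have "f y = norm y"
    using neg[of y] le[of y] by simp
  moreover have "\<bar>f x\<bar> \<le> norm x" for x
    using le[of x] le[of "- x"] neg[of x] by simp
  ultimately show ?thesis
    using that f(1) by blast
qed

text \<open>A norming functional is rescaled by a factor equal to \<open>norm y\<close> up to sign;
  the sign carries homogeneity in the second argument to negative scalars.\<close>

lemma compatible_sip_exists: "\<exists>s. s \<in> (compatible_sips :: ('a::real_normed_vector \<Rightarrow> 'a \<Rightarrow> real) set)"
proof -
  have "\<exists>f. linear f \<and> (\<forall>x. \<bar>f x\<bar> \<le> norm x) \<and> f v = norm v" for v :: 'a
    using norming_functional[of v] by metis
  then obtain g :: "'a \<Rightarrow> 'a \<Rightarrow> real" where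
    g: "\<And>v. linear (g v)" "\<And>v x. \<bar>g v x\<bar> \<le> norm x" "\<And>v. g v v = norm v"
    by metis
  \<comment> \<open>One functional per line through the origin: this yields homogeneity in the second argument.\<close>
  define rep :: "'a \<Rightarrow> 'a" where "rep y = (SOME v. span {v} = span {y})" for y
  define s where "s x y = g (rep y) y * g (rep y) x" for x y
  have span_rep: "span {rep y} = span {y}" for y
    unfolding rep_def by (rule someI[of _ y]) simp
  \<comment> \<open>A nonzero multiple spans the same line, and the choice depends on the line
    only.\<close>
  have rep_scale: "rep (a *\<^sub>R y) = rep y" if "a \<noteq> 0" for a y
    using that by (simp add: rep_def span_image_scale[of "{y}" "\<lambda>_. a", simplified])
  have zero: "g v 0 = 0" for v
    using g(1) by (rule linear_0)
  have scale: "g v (a *\<^sub>R x) = a * g v x" for v a x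
    using linear_scale[OF g(1)] by simp
  have add: "g v (x + y) = g v x + g v y" for v x y
    using linear_add[OF g(1)] by simp
  have diag: "s y y = (norm y)\<^sup>2" for y
  proof -
    have "y \<in> span {rep y}"
      by (simp add: span_rep span_base)
    then obtain c where "y = c *\<^sub>R rep y"
      by (auto simp: span_singleton)
    then have "g (rep y) y = c * norm (rep y)" "norm y = \<bar>c\<bar> * norm (rep y)"
      using scale[of "rep y" c "rep y"] g(3)[of "rep y"] by (metis, metis norm_scaleR)
    then show ?thesis
      by (simp add: s_def power2_eq_square)
  qed
  have "\<bar>s x y\<bar>\<^sup>2 \<le> s x x * s y y" for x y
  proof -
    have "\<bar>s x y\<bar> \<le> norm y * norm x"
      unfolding s_def abs_mult by (intro mult_mono g(2)) auto
    then have "\<bar>s x y\<bar>\<^sup>2 \<le> (norm y * norm x)\<^sup>2"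
      by (intro power_mono) auto
    then show ?thesis
      unfolding diag by (simp add: power_mult_distrib mult.commute)
  qed
  moreover have "s x (a *\<^sub>R y) = a * s x y" for a x y
    by (cases "a = 0") (simp_all add: s_def rep_scale scale zero)
  moreover have "s (a *\<^sub>R x + b *\<^sub>R y) z = a * s x z + b * s y z" for a b x y z
    by (simp add: s_def add scale algebra_simps)
  ultimately have "s \<in> compatible_sips"
    by (simp add: compatible_sips_def semi_inner_product_def diag)
  then show ?thesis by blast
qed

section \<open>Calculus of compatible semi-inner-products\<close>

lemma sip_add_scale:
  assumes "s \<in> compatible_sips"
  shows "s (x + b *\<^sub>R y) z = s x z + b * s y z"
proof -
  have "s (1 *\<^sub>R x + b *\<^sub>R y) z = 1 * s x z + b * s y z"
    using assms unfolding compatible_sips_def semi_inner_product_def by blast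
  then show ?thesis by simp
qed

lemma sip_minus_left:
  assumes "s \<in> compatible_sips"
  shows "s (- x) z = - s x z"
  using sip_add_scale[OF assms, of x "- 2" x z] by (simp add: scaleR_2)

lemma sip_zero_left:
  assumes "s \<in> compatible_sips"
  shows "s 0 z = 0"
  using sip_minus_left[OF assms, of 0 z] by simp

lemma sip_self: "s \<in> compatible_sips \<Longrightarrow> s x x = (norm x)\<^sup>2"
  by (simp add: compatible_sips_def)

lemma abs_sip_le:
  assumes "s \<in> compatible_sips"
  shows "\<bar>s x y\<bar> \<le> norm x * norm y"
proof -
  have "\<bar>s x y\<bar>\<^sup>2 \<le> s x x * s y y"
    using assms unfolding compatible_sips_def semi_inner_product_def by blast
  then have "\<bar>s x y\<bar>\<^sup>2 \<le> (norm x * norm y)\<^sup>2"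
    by (simp add: sip_self[OF assms] power_mult_distrib)
  then show ?thesis
    by (rule power2_le_imp_le) simp
qed

lemma sip_blinfun_le:
  assumes "s \<in> compatible_sips" "norm x = 1" "norm y = 1"
  shows "s (blinfun_apply T x) y \<le> norm T"
  using abs_sip_le[OF assms(1), of "T x" y] norm_blinfun[of T x] assms(2,3) by simp

section \<open>Almost norming vectors\<close>

text \<open>Otherwise homogeneity bounds the operator norm by \<open>r\<close>. The condition
  \<open>0 \<le> r\<close> matters on the zero space, which has no unit vectors.\<close>

lemma blinfun_almost_attains_norm:
  fixes B :: "'a::real_normed_vector \<Rightarrow>\<^sub>L 'b::real_normed_vector"
  assumes "0 \<le> r" "r < norm B"
  obtains x where "norm x = 1" "r < norm (B x)"
proof -
  have "\<exists>x. norm x = 1 \<and> r < norm (B x)"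
  proof (rule ccontr)
    assume "\<not> ?thesis"
    then have le: "norm (B x) \<le> r" if "norm x = 1" for x
      using that by force
    have "norm (B x) \<le> r * norm x" for x
    proof (cases "x = 0")
      case False
      then have "norm (B (x /\<^sub>R norm x)) \<le> r"
        by (intro le) simp
      with False show ?thesis
        by (simp add: blinfun.scaleR_right field_simps)
    qed (simp add: blinfun.zero_right)
    then have "norm B \<le> r"
      using assms(1) by (intro norm_blinfun_bound)
    with assms(2) show False by simp
  qed
  with that show ?thesis by blast
qed

lemma approx_pos_of_sip_nonneg:
  assumes s: "s \<in> compatible_sips" and y: "norm y = 1" and "0 \<le> s v y"
  shows "v \<in> approx_pos \<epsilon> y"
proof -
  have "sqrt (1 - \<epsilon>\<^sup>2) * norm y \<le> norm (y + l *\<^sub>R v)" if "l \<ge> 0" for l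
  proof -
    \<comment> \<open>This covers \<open>\<epsilon> > 1\<close> too, where the root is
      negative.\<close>
    have "sqrt (1 - \<epsilon>\<^sup>2) \<le> 1" by simp
    also have "\<dots> \<le> s (y + l *\<^sub>R v) y"
      using that assms(3) by (simp add: sip_add_scale[OF s] sip_self[OF s] y)
    also have "\<dots> \<le> norm (y + l *\<^sub>R v)"
      using abs_sip_le[OF s, of "y + l *\<^sub>R v" y] y by simp
    finally show ?thesis using y by simp
  qed
  then show ?thesis
    by (simp add: approx_pos_def)
qed

lemma orthogonal_almost_norming:
  fixes T A :: "'a::real_normed_vector \<Rightarrow>\<^sub>L 'b::real_normed_vector"
  assumes orth: "T \<bottom>\<^sub>B A" and "\<epsilon> > 0" "\<delta> > 0" "\<delta> < norm T"
  obtains x y s where "norm x = 1" "norm y = 1" "s \<in> compatible_sips"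
    "norm T - \<delta> < s (T x) y" "- \<epsilon> < s (A x) y"
proof -
  obtain s :: "'b \<Rightarrow> 'b \<Rightarrow> real" where s: "s \<in> compatible_sips"
    using compatible_sip_exists by blast
  \<comment> \<open>The scalar splits the error \<open>\<delta>\<close>:
    \<open>k * \<epsilon>\<close> is lost in almost attaining the norm of
    \<open>T + k *\<^sub>R A\<close>, and \<open>k * norm A\<close> in dropping the term with
    \<open>A\<close>.\<close>
  define k where "k = \<delta> / (\<epsilon> + norm A)"
  have "\<epsilon> + norm A > 0"
    using \<open>\<epsilon> > 0\<close> by (simp add: add_pos_nonneg)
  then have k: "k > 0" "k * \<epsilon> + k * norm A = \<delta>"
    using \<open>\<delta> > 0\<close> by (simp_all add: k_def flip: distrib_left add_divide_distrib)
  have kA: "0 \<le> k * norm A" and ke: "0 < k * \<epsilon>"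
    using k(1) \<open>\<epsilon> > 0\<close> by simp_all
  define B where "B = T + k *\<^sub>R A"
  have "norm T \<le> norm B"
    using orth by (simp add: B_def birkhoff_james_orthogonal_def)
  \<comment> \<open>Since \<open>\<delta> < norm T\<close>, the threshold is positive, so
    \<open>B x\<close> is nonzero and can be normalized.\<close>
  then obtain x where x: "norm x = 1" and Bx: "norm T - k * \<epsilon> < norm (B x)"
    using blinfun_almost_attains_norm[of "norm T - k * \<epsilon>" B] kA ke k(2) assms(4) by auto
  define y where "y = B x /\<^sub>R norm (B x)"
  have pos: "norm (B x) > 0"
    using Bx kA k(2) assms(4) by linarith
  then have y: "norm y = 1"
    by (simp add: y_def)
  have "s (B x) y = norm (B x) * s y y"
    using sip_add_scale[OF s, of 0 "norm (B x)" y y] pos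
    by (simp add: y_def sip_zero_left[OF s])
  then have "s (B x) y = norm (B x)"
    by (simp add: sip_self[OF s] y)
  moreover have "s (B x) y = s (T x) y + k * s (A x) y"
    by (simp add: B_def blinfun.add_left blinfun.scaleR_left sip_add_scale[OF s])
  ultimately have sum: "norm T - k * \<epsilon> < s (T x) y + k * s (A x) y"
    using Bx by simp
  have "k * s (A x) y \<le> k * norm A"
    using k(1) by (intro mult_left_mono sip_blinfun_le s x y) simp
  then have T: "norm T - \<delta> < s (T x) y"
    using sum k(2) by linarith
  have "k * (- \<epsilon>) < k * s (A x) y"
    using sum sip_blinfun_le[OF s x y, of T] by simp
  then have "- \<epsilon> < s (A x) y"
    using k(1) mult_less_cancel_left_pos by blast
  with that x y s T show ?thesis by blast
qed

section \<open>Comparison of the suprema with the norm\<close>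

text \<open>The condition \<open>0 \<le> b\<close> covers the empty set.\<close>

lemma sup0_le:
  assumes "\<And>r. r \<in> S \<Longrightarrow> r \<le> b" "0 \<le> b"
  shows "sup0 S \<le> b"
  using assms by (auto simp: sup0_def intro: cSup_least)

lemma sup0_upper:
  assumes "r \<in> S" "\<And>r. r \<in> S \<Longrightarrow> r \<le> b"
  shows "r \<le> sup0 S"
  using assms by (auto simp: sup0_def intro!: cSup_upper bdd_aboveI)

lemma l1_le_norm: "l1 T A \<epsilon> \<le> norm T"
  unfolding l1_def by (rule sup0_le) (auto intro: sip_blinfun_le)

lemma l2_le_norm: "l2 T A \<epsilon> \<le> norm T"
  unfolding l2_def by (rule sup0_le) (auto intro: sip_blinfun_le)

lemma sip_le_l1:
  assumes "norm x = 1" "norm y = 1" "s \<in> compatible_sips" "\<bar>s (blinfun_apply A x) y\<bar> < \<epsilon>"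
  shows "s (blinfun_apply T x) y \<le> l1 T A \<epsilon>"
  unfolding l1_def by (rule sup0_upper[where b = "norm T"]) (use assms in \<open>auto intro: sip_blinfun_le\<close>)

lemma sip_le_l2:
  assumes "norm x = 1" "norm y = 1" "s \<in> compatible_sips" "blinfun_apply A x \<in> approx_pos \<epsilon> y"
  shows "s (blinfun_apply T x) y \<le> l2 T A \<epsilon>"
  unfolding l2_def by (rule sup0_upper[where b = "norm T"]) (use assms in \<open>auto intro: sip_blinfun_le\<close>)

text \<open>Settles \<open>T = 0\<close>, where no \<open>\<delta>\<close> with
  \<open>0 < \<delta> < norm T\<close> exists.\<close>

lemma l1_zero: "l1 0 A \<epsilon> = 0"
proof -
  have sup0: "sup0 S = 0" if "S \<subseteq> {0}" for S
    using that by (auto simp: sup0_def subset_singleton_iff)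
  show ?thesis
    unfolding l1_def by (rule sup0) (auto simp: sip_zero_left)
qed

lemma norm_eq_max_l1_l2:
  fixes T A :: "'a::real_normed_vector \<Rightarrow>\<^sub>L 'b::real_normed_vector"
  assumes orth: "T \<bottom>\<^sub>B A" and eps: "\<epsilon> > 0"
  shows "norm T = max (l1 T A \<epsilon>) (l2 T A \<epsilon>)"
proof (rule order_antisym)
  show "norm T \<le> max (l1 T A \<epsilon>) (l2 T A \<epsilon>)"
  proof (cases "T = 0")
    case True
    then show ?thesis by (simp add: l1_zero)
  next
    case False
    have *: "norm T - d < max (l1 T A \<epsilon>) (l2 T A \<epsilon>)" if d: "d > 0" "d < norm T" for d
    proof -
      obtain x y s where xys: "norm x = 1" "norm y = 1" "s \<in> compatible_sips"
        and T: "norm T - d < s (T x) y" and A: "- \<epsilon> < s (A x) y"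
        using orthogonal_almost_norming[OF orth eps d] by blast
      show ?thesis
      proof (cases "s (A x) y < \<epsilon>")
        case True
        with A have "s (T x) y \<le> l1 T A \<epsilon>"
          by (intro sip_le_l1 xys) simp
        with T show ?thesis by simp
      next
        case False
        with eps have "s (T x) y \<le> l2 T A \<epsilon>"
          by (intro sip_le_l2 xys approx_pos_of_sip_nonneg[OF xys(3,2)]) simp
        with T show ?thesis by simp
      qed
    qed
    show ?thesis
    proof (rule field_le_epsilon)
      fix e :: real
      assume "e > 0"
      \<comment> \<open>The cap \<open>norm T / 2\<close> keeps \<open>d\<close> strictly below
        \<open>norm T\<close>.\<close>
      define d where "d = min e (norm T / 2)"
      have "0 < d" "d < norm T" "d \<le> e"
        using \<open>e > 0\<close> False by (auto simp: d_def min_def)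
      then show "norm T \<le> max (l1 T A \<epsilon>) (l2 T A \<epsilon>) + e"
        using *[of d] by linarith
    qed
  qed
qed (simp add: l1_le_norm l2_le_norm)

section \<open>Passing from \<open>A\<close> to \<open>- A\<close>\<close>

lemma orthogonal_uminus:
  assumes "u \<bottom>\<^sub>B v"
  shows "u \<bottom>\<^sub>B - v"
  unfolding birkhoff_james_orthogonal_def
proof
  fix l :: real
  show "norm u \<le> norm (u + l *\<^sub>R - v)"
    using assms[unfolded birkhoff_james_orthogonal_def, rule_format, of "- l"] by simp
qed

lemma approx_neg_iff_uminus_approx_pos: "v \<in> approx_neg \<epsilon> u \<longleftrightarrow> - v \<in> approx_pos \<epsilon> u"
proof -
  have "(\<forall>l\<le>0. P l) \<longleftrightarrow> (\<forall>l\<ge>0. P (- l))" for P :: "real \<Rightarrow> bool"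
    by (metis minus_minus neg_0_le_iff_le neg_le_0_iff_le)
  then show ?thesis
    by (simp add: approx_neg_def approx_pos_def)
qed

lemma l3_eq_l2_uminus: "l3 T A \<epsilon> = l2 T (- A) \<epsilon>"
  by (simp add: l3_def l2_def approx_neg_iff_uminus_approx_pos blinfun.minus_left)

lemma l1_uminus: "l1 T (- A) \<epsilon> = l1 T A \<epsilon>"
  \<comment> \<open>The congruence rule makes the membership of \<open>s\<close> available where
    \<open>sip_minus_left\<close> rewrites the last conjunct.\<close>
  unfolding l1_def by (simp add: blinfun.minus_left sip_minus_left cong: conj_cong)

theorem theorem2p6:
  fixes T A :: "'a::real_normed_vector \<Rightarrow>\<^sub>L 'b::real_normed_vector"
    and \<epsilon> :: real
  assumes "T \<bottom>\<^sub>B A"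
    and "\<epsilon> > 0"
  shows "norm T = max (l1 T A \<epsilon>) (l2 T A \<epsilon>) \<and>
         max (l1 T A \<epsilon>) (l2 T A \<epsilon>) = max (l1 T A \<epsilon>) (l3 T A \<epsilon>)"
  \<comment> \<open>Both maxima equal \<open>norm T\<close>: the second is the first one for
    \<open>- A\<close>.\<close>
  using norm_eq_max_l1_l2[OF assms] norm_eq_max_l1_l2[OF orthogonal_uminus[OF assms(1)] assms(2)]
  by (simp add: l3_eq_l2_uminus l1_uminus)

end
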